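(* For every integer $r\geq 3$, there exist a constant $C_r>0$ and integers $\Delta_0=\Delta_0(r)$, $n_0=n_0(r)$ such that the following holds. If $G$ is an $r$-uniform hypergraph on $n\geq n_0$ vertices with maximum degree $\Delta(G)=\Delta\geq \Delta_0$, then $$\tilde{\theta}(G)\leq C_r\,\Delta^3\log n.$$ Further, if $G$ is in addition linear, then $$\tilde{\theta}(G)\leq C_r\,\Delta^{2+\frac{1}{r-1}}\log n.$$
   Context: An $r$-uniform hypergraph $G$ consists of a finite vertex set $V(G)$ and a set $E(G)$ of $r$-element subsets of $V(G)$, called edges. The degree $d(v)$ of a vertex $v$ is the number of edges containing $v$, and $\Delta(G)$ is the maximum degree. $G$ is linear if any two distinct edges intersect in at most one vertex. For a positive integer $k$, a finite set $S$ $k$-represents $G$ if there is a family $(S_v)_{v\in V(G)}$ of subsets of $S$ such that for every $r$-element set $\{v_1,\dots,v_r\}\subseteq V(G)$, $$\{v_1,\dots,v_r\}\in E(G)\iff \left|\bigcap_{i=1}^r S_{v_i}\right|\geq k.$$ $\theta_k(G)$ is the smallest cardinality of a set that $k$-represents $G$, and $\tilde{\theta}(G):=\min_{k\in\mathbb{N}}\theta_k(G)$, where $k$ ranges over the positive integers. Here $\log$ is the natural logarithm. *)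

theory Defs
  imports Complex_Main
begin

definition uniform_hypergraph :: "nat \<Rightarrow> 'a set \<Rightarrow> 'a set set \<Rightarrow> bool" where
  "uniform_hypergraph r V E \<longleftrightarrow> finite V \<and> (\<forall>e\<in>E. e \<subseteq> V \<and> card e = r)"

definition degree :: "'a set set \<Rightarrow> 'a \<Rightarrow> nat" where
  "degree E v = card {e \<in> E. v \<in> e}"

text \<open>Unspecified for empty \<open>V\<close>, where there is no maximum.\<close>

definition max_degree :: "'a set \<Rightarrow> 'a set set \<Rightarrow> nat" where
  "max_degree V E = Max (degree E ` V)"

definition linear_hypergraph :: "'a set set \<Rightarrow> bool" where
  "linear_hypergraph E \<longleftrightarrow> (\<forall>e\<in>E. \<forall>f\<in>E. e \<noteq> f \<longrightarrow> card (e \<inter> f) \<le> 1)"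

text \<open>The uniformity \<open>r\<close> is an explicit parameter because an edgeless \<open>E\<close> does not determine it.\<close>

definition k_represents ::
  "nat \<Rightarrow> nat \<Rightarrow> 'a set \<Rightarrow> 'a set set \<Rightarrow> 's set \<Rightarrow> bool" where
  "k_represents r k V E S \<longleftrightarrow> finite S \<and>
     (\<exists>F :: 'a \<Rightarrow> 's set. (\<forall>v\<in>V. F v \<subseteq> S) \<and>
        (\<forall>A. A \<subseteq> V \<and> card A = r \<longrightarrow> (A \<in> E \<longleftrightarrow> card (\<Inter>v\<in>A. F v) \<ge> k)))"

text \<open>Only the cardinality of the representing set matters, so sets of naturals suffice. The
  minimum is over a nonempty set by \<open>ex_k_represents\<close> below.\<close>

definition theta :: "nat \<Rightarrow> nat \<Rightarrow> 'a set \<Rightarrow> 'a set set \<Rightarrow> nat" where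
  "theta r k V E = (LEAST m. \<exists>S :: nat set. k_represents r k V E S \<and> card S = m)"

text \<open>An infimum of a nonempty set of naturals, hence a minimum.\<close>

definition theta_min :: "nat \<Rightarrow> 'a set \<Rightarrow> 'a set set \<Rightarrow> nat" where
  "theta_min r V E = (INF k\<in>{1..}. theta r k V E)"

lemma ex_k_represents:
  assumes G: "uniform_hypergraph r V E" and r: "r \<ge> 1" and k: "k \<ge> 1"
  shows "\<exists>S :: nat set. k_represents r k V E S"
proof -
  have V: "finite V" and E: "\<And>e. e \<in> E \<Longrightarrow> e \<subseteq> V \<and> card e = r"
    using G by (auto simp: uniform_hypergraph_def)
  have "E \<subseteq> Pow V" using E by auto
  then have "finite E" using V by (simp add: finite_subset)
  then have "finite (E \<times> {..<k})" by simp
  then obtain f :: "'a set \<times> nat \<Rightarrow> nat" where f: "inj_on f (E \<times> {..<k})"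
    using finite_imp_inj_to_nat_seg by metis
  define F where "F v = f ` ({e \<in> E. v \<in> e} \<times> {..<k})" for v
  have "A \<in> E \<longleftrightarrow> card (\<Inter>v\<in>A. F v) \<ge> k" if A: "A \<subseteq> V" "card A = r" for A
  proof -
    have "A \<noteq> {}" using A r by auto
    then obtain a where "a \<in> A" by blast
    have "f ` (\<Inter>v\<in>A. {e \<in> E. v \<in> e} \<times> {..<k}) = (\<Inter>v\<in>A. F v)"
      unfolding F_def by (rule image_INT[OF f _ \<open>a \<in> A\<close>]) auto
    moreover have "(\<Inter>v\<in>A. {e \<in> E. v \<in> e} \<times> {..<k}) = {e \<in> E. A \<subseteq> e} \<times> {..<k}"
      using \<open>a \<in> A\<close> by auto
    moreover have "e = A" if "e \<in> E" "A \<subseteq> e" for e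
      using E[OF that(1)] A that V card_subset_eq[of e A] finite_subset[of e V] by simp
    then have "{e \<in> E. A \<subseteq> e} = (if A \<in> E then {A} else {})"
      by (cases "A \<in> E") auto
    ultimately have "(\<Inter>v\<in>A. F v) = f ` ((if A \<in> E then {A} else {}) \<times> {..<k})" by simp
    moreover have "card (f ` ({A} \<times> {..<k})) = k" if "A \<in> E"
      using that by (subst card_image[OF inj_on_subset[OF f]]) auto
    ultimately show ?thesis using k by auto
  qed
  moreover have "\<forall>v\<in>V. F v \<subseteq> f ` (E \<times> {..<k})" unfolding F_def by auto
  ultimately have "k_represents r k V E (f ` (E \<times> {..<k}))"
    unfolding k_represents_def using \<open>finite E\<close> by auto
  then show ?thesis by blast
qed

end

theory Submission
  imports Defs "HOL-Library.FuncSet"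
begin

text \<open>
  Both bounds hold because every \<open>r\<close>-uniform hypergraph satisfies the stronger estimate
  \<open>theta_min \<le> C * \<Delta>\<^sup>2 * ln n\<close> (\<open>theta_min_le_square\<close>), and \<open>\<Delta>\<^sup>2\<close> is at most both
  \<open>\<Delta>\<^sup>3\<close> and \<open>\<Delta> powr (2 + 1 / (r - 1))\<close> as soon as \<open>\<Delta> \<ge> 1\<close>.

  Fix \<open>Q = 8 * r * \<Delta>\<^sup>2\<close>, choose every edge independently with probability \<open>1 / Q\<close>, and let \<open>T\<close> be
  the union of the chosen edges. An edge lies inside \<open>T\<close> with probability at least \<open>1 / Q\<close>. For a
  non-edge \<open>A\<close> with \<open>r\<close> vertices, one edge cannot cover \<open>A\<close>, so \<open>A \<subseteq> T\<close> forces two different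
  chosen edges that meet \<open>A\<close>, one of them at a prescribed vertex of \<open>A\<close>; there are at most
  \<open>r * \<Delta>\<^sup>2\<close> such pairs and each is chosen with probability \<open>1 / Q\<^sup>2\<close>, so \<open>A \<subseteq> T\<close> has
  probability at most \<open>1 / (8 * Q)\<close> (\<open>nonedge_rarely_covered\<close>).

  Now draw \<open>m = 2 * k * Q\<close> independent copies \<open>T j\<close> and put \<open>j\<close> into the set of \<open>v\<close> when
  \<open>v \<in> T j\<close>. The intersection of the sets of the vertices in \<open>A\<close> counts the \<open>j\<close> with \<open>A \<subseteq> T j\<close>.
  This count has mean at least \<open>2 * k\<close> for an edge and at most \<open>k / 4\<close> for a non-edge, and by
  exponential moments the probability that it lies on the wrong side of \<open>k\<close> is at most
  \<open>exp (- k / 4)\<close>. There are at most \<open>n ^ r\<close> sets \<open>A\<close>, so \<open>k\<close> slightly above \<open>4 * r * ln n\<close>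
  makes all counts right at once (\<open>exists_samples_separating\<close>).

  Probabilities are rendered as proportions in a finite sample space, and the independent draws as
  a one-by-one choice that keeps the sum of the exponential moments below its average.
\<close>

section \<open>Repeated sampling\<close>

text \<open>
  The method of conditional expectations: the average over \<open>x\<close> of the new potential
  \<open>\<Sum>i\<in>I. (\<Prod>j<m. w i (\<omega> j)) * w i x\<close> is at most \<open>\<rho>\<close> times the old one, so some \<open>x\<close> does no
  worse than the average.
\<close>

lemma exists_sequence_below_average:
  fixes w :: "'i \<Rightarrow> 'x \<Rightarrow> real" and \<rho> :: real
  assumes \<Omega>: "finite \<Omega>" "\<Omega> \<noteq> {}"
    and nonneg: "\<And>i x. i \<in> I \<Longrightarrow> 0 \<le> w i x"
    and avg: "\<And>i. i \<in> I \<Longrightarrow> (\<Sum>x\<in>\<Omega>. w i x) \<le> \<rho> * card \<Omega>" and \<rho>: "0 \<le> \<rho>"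
  shows "\<exists>\<omega>. (\<forall>j. \<omega> j \<in> \<Omega>) \<and> (\<Sum>i\<in>I. \<Prod>j<m. w i (\<omega> j)) \<le> card I * \<rho> ^ m"
proof (induction m)
  case 0
  then show ?case using \<Omega>(2) by auto
next
  case (Suc m)
  then obtain \<omega> where \<omega>: "\<And>j. \<omega> j \<in> \<Omega>" "(\<Sum>i\<in>I. \<Prod>j<m. w i (\<omega> j)) \<le> card I * \<rho> ^ m"
    by auto
  let ?\<Phi> = "\<lambda>i. \<Prod>j<m. w i (\<omega> j)"
  have "\<exists>x\<in>\<Omega>. (\<Sum>i\<in>I. ?\<Phi> i * w i x) \<le> \<rho> * (\<Sum>i\<in>I. ?\<Phi> i)"
  proof (rule ccontr)
    assume "\<not> ?thesis"
    then have "(\<Sum>x\<in>\<Omega>. \<rho> * (\<Sum>i\<in>I. ?\<Phi> i)) < (\<Sum>x\<in>\<Omega>. \<Sum>i\<in>I. ?\<Phi> i * w i x)"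
      using \<Omega> by (intro sum_strict_mono) auto
    also have "\<dots> = (\<Sum>i\<in>I. ?\<Phi> i * (\<Sum>x\<in>\<Omega>. w i x))"
      by (subst sum.swap) (simp add: sum_distrib_left)
    also have "\<dots> \<le> (\<Sum>i\<in>I. ?\<Phi> i * (\<rho> * card \<Omega>))"
      by (intro sum_mono mult_left_mono avg prod_nonneg ballI nonneg)
    also have "\<dots> = (\<Sum>x\<in>\<Omega>. \<rho> * (\<Sum>i\<in>I. ?\<Phi> i))"
      by (simp add: sum_distrib_left sum_distrib_right mult_ac)
    finally show False by simp
  qed
  then obtain x where x: "x \<in> \<Omega>" "(\<Sum>i\<in>I. ?\<Phi> i * w i x) \<le> \<rho> * (\<Sum>i\<in>I. ?\<Phi> i)" by blast
  have "(\<Sum>i\<in>I. \<Prod>j<Suc m. w i ((\<omega>(m := x)) j)) = (\<Sum>i\<in>I. ?\<Phi> i * w i x)" by simp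
  also have "\<dots> \<le> \<rho> * (card I * \<rho> ^ m)"
    using x(2) mult_left_mono[OF \<omega>(2) \<rho>] by linarith
  finally have "(\<Sum>i\<in>I. \<Prod>j<Suc m. w i ((\<omega>(m := x)) j)) \<le> card I * \<rho> ^ Suc m"
    by (simp add: mult_ac)
  then show ?case using \<omega>(1) x(1) by (intro exI[of _ "\<omega>(m := x)"]) auto
qed

text \<open>
  A simultaneous Chernoff bound. With \<open>N\<close> the number of samples that hit \<open>X i\<close>, the potential of
  \<open>i\<close> is \<open>2 ^ k / 2 ^ N\<close> for \<open>i \<in> D\<close> and \<open>2 ^ N / 2 ^ k\<close> otherwise. It is at least \<open>1\<close> whenever
  \<open>N\<close> is on the wrong side of \<open>k\<close>, while on average each of the \<open>2 * k * Q\<close> steps shrinks it by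
  the factor \<open>exp (- 1 / (8 * Q))\<close>, because \<open>1 / 2 \<le> ln 2 \<le> 3 / 4\<close>.
\<close>

lemma exists_samples_separating:
  fixes X :: "'i \<Rightarrow> 'x set" and k Q :: nat
  assumes \<Omega>: "finite \<Omega>" "\<Omega> \<noteq> {}" and I: "finite I" "card I < exp (k / 4)" and Q: "0 < Q"
    and sub: "\<And>i. i \<in> I \<Longrightarrow> X i \<subseteq> \<Omega>"
    and frequent: "\<And>i. i \<in> I \<Longrightarrow> i \<in> D \<Longrightarrow> card \<Omega> \<le> Q * card (X i)"
    and rare: "\<And>i. i \<in> I \<Longrightarrow> i \<notin> D \<Longrightarrow> 8 * Q * card (X i) \<le> card \<Omega>"
  shows "\<exists>\<omega>. (\<forall>j. \<omega> j \<in> \<Omega>) \<and> (\<forall>i\<in>I. i \<in> D \<longleftrightarrow> k \<le> card {j. j < 2 * k * Q \<and> \<omega> j \<in> X i})"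
proof -
  \<comment> \<open>The proportion \<open>k / m\<close> of samples at which the two kinds of sets are separated.\<close>
  define h :: real where "h = 1 / (2 * Q)"
  define m where "m = 2 * k * Q"
  have h: "0 < h" and mh: "m * h = k" using Q by (auto simp: h_def m_def)
  define c where "c i = (if i \<in> D then exp (h * ln 2) else exp (- h * ln 2))" for i
  define b :: "'i \<Rightarrow> real" where "b i = (if i \<in> D then 1 / 2 else 2)" for i
  define w where "w i x = c i * (if x \<in> X i then b i else 1)" for i x
  have ln2: "1 / 2 \<le> ln (2::real)" "ln (2::real) \<le> 3 / 4"
  proof -
    have "exp (1 / 2 :: real) \<le> 1 + 1 / 2 + (1 / 2)\<^sup>2" by (rule exp_bound) auto
    then show "1 / 2 \<le> ln (2::real)" by (subst ln_ge_iff) (auto simp: power2_eq_square)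
    have "1 + 3 / 4 + (3 / 4)\<^sup>2 / 2 \<le> exp (3 / 4 :: real)" by (rule exp_lower_Taylor_quadratic) auto
    then have "2 \<le> exp (3 / 4 :: real)" by (simp add: power2_eq_square)
    then show "ln (2::real) \<le> 3 / 4" using ln_mono[of 2 "exp (3/4) :: real"] by simp
  qed
  have nonneg: "0 \<le> w i x" for i x by (auto simp: w_def c_def b_def)
  have avg: "(\<Sum>x\<in>\<Omega>. w i x) \<le> exp (- h / 4) * card \<Omega>" if i: "i \<in> I" for i
  proof -
    have fin: "finite (X i)" using sub[OF i] \<Omega>(1) finite_subset by blast
    have card: "real (card (\<Omega> - X i)) = real (card \<Omega>) - card (X i)"
      using sub[OF i] \<Omega>(1) by (simp add: card_Diff_subset fin card_mono of_nat_diff)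
    have inner: "(\<Sum>x\<in>\<Omega>. if x \<in> X i then b i else 1) = card (X i) * b i + card (\<Omega> - X i)"
      using sub[OF i] by (subst sum.If_cases[OF \<Omega>(1)]) (simp_all add: Int_absorb1 Diff_eq)
    have sum: "(\<Sum>x\<in>\<Omega>. w i x) = c i * (card \<Omega> + (b i - 1) * card (X i))"
      unfolding w_def sum_distrib_left[symmetric] inner card by (simp add: algebra_simps)
    show ?thesis
    proof (cases "i \<in> D")
      case True
      have "real (card \<Omega>) \<le> Q * card (X i)" using frequent[OF i True] of_nat_mono by fastforce
      then have "card \<Omega> + (b i - 1) * card (X i) \<le> (1 - h) * card \<Omega>"
        using True Q by (simp add: b_def h_def field_simps)
      also have "\<dots> \<le> exp (- h) * card \<Omega>"
        using exp_ge_add_one_self[of "- h"] by (intro mult_right_mono) auto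
      finally have "(\<Sum>x\<in>\<Omega>. w i x) \<le> c i * (exp (- h) * card \<Omega>)"
        unfolding sum using True by (intro mult_left_mono) (auto simp: c_def)
      also have "\<dots> = exp (h * ln 2 + - h) * card \<Omega>"
        by (simp only: c_def True if_True exp_add mult.assoc)
      also have "\<dots> \<le> exp (- h / 4) * card \<Omega>"
      proof -
        have "h * ln 2 + - h \<le> - h / 4" using mult_left_mono[OF ln2(2), of h] h by linarith
        then show ?thesis by (intro mult_right_mono) auto
      qed
      finally show ?thesis .
    next
      case False
      have "8 * real Q * card (X i) \<le> card \<Omega>"
        using rare[OF i False] of_nat_mono by fastforce
      then have "card \<Omega> + (b i - 1) * card (X i) \<le> (1 + h / 4) * card \<Omega>"
        using False Q by (simp add: b_def h_def field_simps)
      also have "\<dots> \<le> exp (h / 4) * card \<Omega>"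
        by (intro mult_right_mono exp_ge_add_one_self) auto
      finally have "(\<Sum>x\<in>\<Omega>. w i x) \<le> c i * (exp (h / 4) * card \<Omega>)"
        unfolding sum using False by (intro mult_left_mono) (auto simp: c_def)
      also have "\<dots> = exp (- h * ln 2 + h / 4) * card \<Omega>"
        by (simp only: c_def False if_False exp_add mult.assoc)
      also have "\<dots> \<le> exp (- h / 4) * card \<Omega>"
      proof -
        have "- h * ln 2 + h / 4 \<le> - h / 4" using mult_left_mono[OF ln2(1), of h] h by linarith
        then show ?thesis by (intro mult_right_mono) auto
      qed
      finally show ?thesis .
    qed
  qed
  obtain \<omega> where \<omega>: "\<And>j. \<omega> j \<in> \<Omega>"
    and le: "(\<Sum>i\<in>I. \<Prod>j<m. w i (\<omega> j)) \<le> card I * exp (- h / 4) ^ m"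
    using exists_sequence_below_average[OF \<Omega>, of I w "exp (- h / 4)" m] nonneg avg by auto
  have "exp (- h / 4) ^ m = exp (- (k / 4))"
    by (simp add: mh flip: exp_of_nat_mult)
  moreover have "card I * exp (- (k / 4)) < 1" using I(2) by (simp add: exp_minus field_simps)
  ultimately have total: "(\<Sum>i\<in>I. \<Prod>j<m. w i (\<omega> j)) < 1" using le by simp
  have "i \<in> D \<longleftrightarrow> k \<le> card {j. j < m \<and> \<omega> j \<in> X i}" if i: "i \<in> I" for i
  proof -
    define N where "N = card {j. j < m \<and> \<omega> j \<in> X i}"
    have "(\<Prod>j<m. w i (\<omega> j)) \<le> (\<Sum>i\<in>I. \<Prod>j<m. w i (\<omega> j))"
      by (rule member_le_sum[OF i _ I(1)]) (intro prod_nonneg ballI nonneg)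
    then have "(\<Prod>j<m. w i (\<omega> j)) < 1" using total by linarith
    moreover have "(\<Prod>j<m. w i (\<omega> j)) = c i ^ m * b i ^ N"
      by (simp add: w_def prod.distrib prod.If_cases N_def lessThan_def Collect_conj_eq)
    moreover have "c i ^ m = (if i \<in> D then 2 ^ k else inverse (2 ^ k))"
    proof -
      have "exp (h * ln 2) ^ m = exp (k * ln 2)"
        using mh by (simp add: mult.assoc[symmetric] flip: exp_of_nat_mult)
      also have "\<dots> = 2 ^ k" by (simp add: exp_of_nat_mult)
      finally show ?thesis by (simp add: c_def exp_minus power_inverse)
    qed
    ultimately have "(if i \<in> D then (2::real) ^ k < 2 ^ N else (2::real) ^ N < 2 ^ k)"
      by (auto simp: b_def field_simps split: if_splits)
    then show ?thesis unfolding N_def[symmetric] by (auto split: if_splits)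
  qed
  then show ?thesis using \<omega> unfolding m_def by blast
qed

section \<open>Covering a vertex set by random edges\<close>

text \<open>
  A selection of edges, each chosen independently with probability \<open>1 / Q\<close>, is encoded as a
  uniformly random colouring with \<open>Q\<close> colours, of which the edges of colour \<open>0\<close> are chosen.
\<close>

definition colourings :: "nat \<Rightarrow> 'e set \<Rightarrow> ('e \<Rightarrow> nat) set" where
  "colourings Q E = E \<rightarrow>\<^sub>E {..<Q}"

definition chosen_union :: "'a set set \<Rightarrow> ('a set \<Rightarrow> nat) \<Rightarrow> 'a set" where
  "chosen_union E g = \<Union>{e \<in> E. g e = 0}"

lemma finite_colourings: "finite E \<Longrightarrow> finite (colourings Q E)"
  by (simp add: colourings_def finite_PiE)

lemma colourings_nonempty: "0 < Q \<Longrightarrow> colourings Q E \<noteq> {}"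
  by (auto simp: colourings_def PiE_eq_empty_iff)

lemma card_colourings_all_chosen:
  assumes E: "finite E" and F: "F \<subseteq> E" and Q: "0 < Q"
  shows "Q ^ card F * card {g \<in> colourings Q E. \<forall>e\<in>F. g e = 0} = card (colourings Q E)"
proof -
  have "{g \<in> colourings Q E. \<forall>e\<in>F. g e = 0} = (\<Pi>\<^sub>E e\<in>E. if e \<in> F then {0} else {..<Q})"
    using F Q by (auto simp: colourings_def PiE_iff extensional_def split: if_splits)
  then have "card {g \<in> colourings Q E. \<forall>e\<in>F. g e = 0} = Q ^ card (E - F)"
    using E by (simp add: card_PiE if_distrib[of card] prod.If_cases Diff_eq)
  moreover have "card E = card F + card (E - F)"
    using E F by (metis card_Diff_subset card_mono finite_subset le_add_diff_inverse)
  ultimately show ?thesis using E by (simp add: colourings_def card_PiE power_add)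
qed

text \<open>
  Covering a non-edge takes two different chosen edges: an edge \<open>e\<close> through a fixed vertex \<open>v\<close>
  misses some \<open>u \<in> A\<close>, since \<open>e\<close> and \<open>A\<close> are different sets of the same size, and \<open>u\<close> needs an
  edge \<open>f\<close> of its own. The union bound runs over these \<open>e\<close>, \<open>u\<close> and \<open>f\<close>.
\<close>

lemma nonedge_rarely_covered:
  fixes E :: "'a set set"
  assumes G: "uniform_hypergraph r V E" and r: "1 \<le> r" and Q: "0 < Q"
    and deg: "\<And>v. v \<in> V \<Longrightarrow> degree E v \<le> d"
    and A: "A \<subseteq> V" "card A = r" "A \<notin> E"
  shows "Q\<^sup>2 * card {g \<in> colourings Q E. A \<subseteq> chosen_union E g} \<le> r * d\<^sup>2 * card (colourings Q E)"
proof -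
  have V: "finite V" and edge: "\<And>e. e \<in> E \<Longrightarrow> e \<subseteq> V \<and> card e = r"
    using G by (auto simp: uniform_hypergraph_def)
  have "E \<subseteq> Pow V" using edge by auto
  then have E: "finite E" using V by (simp add: finite_subset)
  have finA: "finite A" using A V finite_subset by blast
  obtain v where v: "v \<in> A" using A(2) r by fastforce
  define P where "P = (SIGMA e:{e \<in> E. v \<in> e}. SIGMA u:A. {f \<in> E. u \<in> f \<and> f \<noteq> e})"
  define W where "W = (\<lambda>(e, u::'a, f). {g \<in> colourings Q E. \<forall>e'\<in>{e, f}. g e' = 0})"
  have finP: "finite P" unfolding P_def using E finA by auto
  have "{g \<in> colourings Q E. A \<subseteq> chosen_union E g} \<subseteq> (\<Union>p\<in>P. W p)"
  proof
    fix g assume "g \<in> {g \<in> colourings Q E. A \<subseteq> chosen_union E g}"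
    then have g: "g \<in> colourings Q E" "A \<subseteq> chosen_union E g" by auto
    then obtain e where e: "e \<in> E" "v \<in> e" "g e = 0" using v by (auto simp: chosen_union_def)
    have "\<not> A \<subseteq> e"
      using card_subset_eq[of e A] edge[OF e(1)] A V e(1) finite_subset[of e V] by auto
    then obtain u where u: "u \<in> A" "u \<notin> e" by blast
    then obtain f where f: "f \<in> E" "u \<in> f" "g f = 0" using g by (auto simp: chosen_union_def)
    have "(e, u, f) \<in> P" "g \<in> W (e, u, f)" using e u f g by (auto simp: P_def W_def)
    then show "g \<in> (\<Union>p\<in>P. W p)" by blast
  qed
  then have "card {g \<in> colourings Q E. A \<subseteq> chosen_union E g} \<le> card (\<Union>p\<in>P. W p)"
    using finP finite_colourings[OF E] by (intro card_mono) (auto simp: W_def)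
  also have "\<dots> \<le> (\<Sum>p\<in>P. card (W p))" by (rule card_UN_le[OF finP])
  finally have "Q\<^sup>2 * card {g \<in> colourings Q E. A \<subseteq> chosen_union E g} \<le> (\<Sum>p\<in>P. Q\<^sup>2 * card (W p))"
    by (simp flip: sum_distrib_left)
  also have "\<dots> = (\<Sum>p\<in>P. card (colourings Q E))"
  proof (rule sum.cong[OF refl])
    fix p assume "p \<in> P"
    then obtain e u f where p: "p = (e, u, f)" "e \<in> E" "f \<in> E" "f \<noteq> e" by (auto simp: P_def)
    then show "Q\<^sup>2 * card (W p) = card (colourings Q E)"
      using card_colourings_all_chosen[OF E, of "{e, f}" Q] Q by (simp add: W_def power2_eq_square)
  qed
  also have "\<dots> = card P * card (colourings Q E)" by simp
  also have "card P \<le> r * d\<^sup>2"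
  proof -
    have "card P = (\<Sum>e\<in>{e \<in> E. v \<in> e}. \<Sum>u\<in>A. card {f \<in> E. u \<in> f \<and> f \<noteq> e})"
      unfolding P_def using E finA by simp
    also have "\<dots> \<le> (\<Sum>e\<in>{e \<in> E. v \<in> e}. \<Sum>u\<in>A. d)"
    proof (intro sum_mono)
      fix e u assume "u \<in> A"
      then have "degree E u \<le> d" using A(1) deg by blast
      moreover have "card {f \<in> E. u \<in> f \<and> f \<noteq> e} \<le> degree E u"
        unfolding degree_def using E by (intro card_mono) auto
      ultimately show "card {f \<in> E. u \<in> f \<and> f \<noteq> e} \<le> d" by linarith
    qed
    also have "\<dots> = degree E v * (r * d)" by (simp add: degree_def A(2))
    also have "\<dots> \<le> d * (r * d)" using deg v A(1) by (intro mult_right_mono) auto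
    finally show ?thesis by (simp add: power2_eq_square mult_ac)
  qed
  finally show ?thesis by simp
qed

section \<open>Representing a hypergraph\<close>

lemma theta_min_le:
  fixes S :: "nat set"
  assumes "1 \<le> k" "k_represents r k V E S"
  shows "theta_min r V E \<le> card S"
proof -
  have "theta_min r V E \<le> theta r k V E"
    unfolding theta_min_def using assms(1) by (intro cINF_lower) auto
  also have "\<dots> \<le> card S"
    unfolding theta_def using assms(2) by (intro Least_le) blast
  finally show ?thesis .
qed

lemma theta_min_le_samples:
  fixes E :: "'a set set"
  assumes G: "uniform_hypergraph r V E" and r: "1 \<le> r" and d: "1 \<le> d" and k: "1 \<le> k"
    and deg: "\<And>v. v \<in> V \<Longrightarrow> degree E v \<le> d"
    and large: "(card V choose r) < exp (k / 4)"
  shows "theta_min r V E \<le> 2 * k * (8 * r * d\<^sup>2)"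
proof -
  have V: "finite V" and edge: "\<And>e. e \<in> E \<Longrightarrow> e \<subseteq> V \<and> card e = r"
    using G by (auto simp: uniform_hypergraph_def)
  have "E \<subseteq> Pow V" using edge by auto
  then have E: "finite E" using V by (simp add: finite_subset)
  define Q where "Q = 8 * r * d\<^sup>2"
  have Q: "0 < Q" using r d by (simp add: Q_def)
  define I where "I = {A. A \<subseteq> V \<and> card A = r}"
  define X where "X A = {g \<in> colourings Q E. A \<subseteq> chosen_union E g}" for A
  have "\<exists>\<omega>. (\<forall>j. \<omega> j \<in> colourings Q E) \<and>
      (\<forall>A\<in>I. A \<in> E \<longleftrightarrow> k \<le> card {j. j < 2 * k * Q \<and> \<omega> j \<in> X A})"
  proof (rule exists_samples_separating[OF finite_colourings[OF E] colourings_nonempty[OF Q]])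
    show "finite I" using V by (simp add: I_def)
    show "card I < exp (k / 4)" using large by (simp add: I_def n_subsets[OF V])
    show "X A \<subseteq> colourings Q E" for A by (auto simp: X_def)
  next
    fix A assume "A \<in> E"
    then have "card (colourings Q E) = Q * card {g \<in> colourings Q E. \<forall>e\<in>{A}. g e = 0}"
      using card_colourings_all_chosen[OF E, of "{A}" Q] Q by simp
    also have "\<dots> \<le> Q * card (X A)"
      using \<open>A \<in> E\<close> finite_colourings[OF E]
      by (intro mult_left_mono card_mono) (auto simp: X_def chosen_union_def)
    finally show "card (colourings Q E) \<le> Q * card (X A)" .
  next
    fix A assume "A \<in> I" "A \<notin> E"
    then have "Q\<^sup>2 * card (X A) \<le> r * d\<^sup>2 * card (colourings Q E)"
      unfolding X_def by (intro nonedge_rarely_covered[OF G r Q deg]) (auto simp: I_def)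
    then have "Q * (8 * Q * card (X A)) \<le> Q * card (colourings Q E)"
      by (simp add: Q_def power2_eq_square algebra_simps)
    then show "8 * Q * card (X A) \<le> card (colourings Q E)" using Q by simp
  qed (use Q in auto)
  then obtain \<omega> where \<omega>: "\<And>j. \<omega> j \<in> colourings Q E"
    and sep: "\<And>A. A \<in> I \<Longrightarrow> A \<in> E \<longleftrightarrow> k \<le> card {j. j < 2 * k * Q \<and> \<omega> j \<in> X A}"
    by blast
  define F where "F v = {j. j < 2 * k * Q \<and> v \<in> chosen_union E (\<omega> j)}" for v
  have "A \<in> E \<longleftrightarrow> k \<le> card (\<Inter>v\<in>A. F v)" if A: "A \<subseteq> V" "card A = r" for A
  proof -
    have "A \<noteq> {}" using A r by auto
    then have "(\<Inter>v\<in>A. F v) = {j. j < 2 * k * Q \<and> \<omega> j \<in> X A}"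
      using \<omega> by (auto simp: F_def X_def)
    then show ?thesis using sep[of A] A by (simp add: I_def)
  qed
  then have "k_represents r k V E {..<2 * k * Q}"
    unfolding k_represents_def by (intro conjI exI[of _ F]) (auto simp: F_def)
  then show ?thesis using theta_min_le[OF k] unfolding Q_def by fastforce
qed

text \<open>
  The union bound over the \<open>r\<close>-sets needs \<open>n ^ r < exp (k / 4)\<close>, so \<open>k\<close> is the least integer above
  \<open>4 * r * ln n\<close>.
\<close>

lemma theta_min_le_square:
  fixes E :: "'a set set"
  assumes G: "uniform_hypergraph r V E" and r: "1 \<le> r" and n: "2 \<le> card V" and d: "1 \<le> d"
    and deg: "\<And>v. v \<in> V \<Longrightarrow> degree E v \<le> d"
  shows "theta_min r V E \<le> 16 * r * (4 * r + 2) * real d ^ 2 * ln (card V)"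
proof -
  define n where "n = card V"
  define k where "k = nat \<lfloor>4 * r * ln n\<rfloor> + 1"
  have "exp (1 / 2 :: real) \<le> 1 + 1 / 2 + (1 / 2)\<^sup>2" by (rule exp_bound) auto
  then have "exp (1 / 2) \<le> real n" using n by (simp add: n_def power2_eq_square)
  then have ln: "1 / 2 \<le> ln (real n)" using n by (subst ln_ge_iff) (auto simp: n_def)
  have nonneg: "0 \<le> 4 * r * ln n" using ln by simp
  have k: "4 * r * ln n < k" "k \<le> 4 * r * ln n + 1" using nonneg real_of_int_floor_add_one_gt[of "4 * r * ln n"] of_int_floor_le[of "4 * r * ln n"]
    by (simp_all add: k_def add.commute)
  have "real (n choose r) \<le> real n ^ r"
  proof (cases "r \<le> n")
    case True
    then show ?thesis using binomial_le_pow by (metis of_nat_le_iff of_nat_power)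
  qed (simp add: binomial_eq_0)
  also have "\<dots> = exp (r * ln n)" using n by (simp add: exp_of_nat_mult n_def)
  also have "\<dots> < exp (k / 4)" using k(1) by simp
  finally have "theta_min r V E \<le> 2 * k * (8 * r * d\<^sup>2)"
    by (intro theta_min_le_samples[OF G r d _ deg]) (auto simp: k_def n_def)
  then have "real (theta_min r V E) \<le> real (2 * k * (8 * r * d\<^sup>2))" by (rule of_nat_mono)
  also have "\<dots> = 16 * r * real d ^ 2 * k" by simp
  also have "\<dots> \<le> 16 * r * real d ^ 2 * ((4 * r + 2) * ln n)"
    using k(2) ln by (intro mult_left_mono) (auto simp: algebra_simps)
  finally show ?thesis by (simp add: n_def algebra_simps)
qed

theorem theorem1p1:
  fixes r :: nat
  assumes "r \<ge> 3"
  shows "\<exists>C :: real. C > 0 \<and> (\<exists>(\<Delta>\<^sub>0 :: nat) (n\<^sub>0 :: nat).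
    \<forall>(V :: 'a set) (E :: 'a set set) (n :: nat) (\<Delta> :: nat).
      uniform_hypergraph r V E \<and> card V = n \<and> n \<ge> n\<^sub>0 \<and> max_degree V E = \<Delta> \<and> \<Delta> \<ge> \<Delta>\<^sub>0 \<longrightarrow>
        real (theta_min r V E) \<le> C * real \<Delta> ^ 3 * ln (real n) \<and>
        (linear_hypergraph E \<longrightarrow>
          real (theta_min r V E) \<le> C * real \<Delta> powr (2 + 1 / (real r - 1)) * ln (real n)))"
proof -
  define C :: real where "C = 16 * r * (4 * r + 2)"
  have C: "C > 0" using assms by (simp only: C_def of_nat_0_less_iff zero_less_mult_iff) simp
  have "real (theta_min r V E) \<le> C * real \<Delta> ^ 3 * ln n \<and>
      real (theta_min r V E) \<le> C * real \<Delta> powr (2 + 1 / (real r - 1)) * ln n"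
    if G: "uniform_hypergraph r V E" and n: "card V = n" "n \<ge> 2"
      and \<Delta>: "max_degree V E = \<Delta>" "\<Delta> \<ge> 1"
    for V :: "'a set" and E n \<Delta>
  proof -
    have "finite V" using G by (simp add: uniform_hypergraph_def)
    then have "degree E v \<le> \<Delta>" if "v \<in> V" for v
      using that unfolding \<Delta>(1)[symmetric] max_degree_def by simp
    then have square: "theta_min r V E \<le> C * real \<Delta> ^ 2 * ln n"
      using theta_min_le_square[OF G, of \<Delta>] assms n \<Delta>(2) by (simp add: C_def algebra_simps)
    have ln: "0 \<le> ln (real n)" using n by simp
    have "real \<Delta> ^ 2 \<le> real \<Delta> ^ 3" using \<Delta>(2) by (intro power_increasing) auto
    then have "C * real \<Delta> ^ 2 * ln n \<le> C * real \<Delta> ^ 3 * ln n"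
      using C ln by (intro mult_right_mono mult_left_mono) auto
    moreover have "real \<Delta> ^ 2 \<le> real \<Delta> powr (2 + 1 / (real r - 1))"
    proof -
      have "real \<Delta> powr 2 \<le> real \<Delta> powr (2 + 1 / (real r - 1))"
        using assms \<Delta>(2) by (intro powr_mono) auto
      then show ?thesis using \<Delta>(2) by simp
    qed
    then have "C * real \<Delta> ^ 2 * ln n \<le> C * real \<Delta> powr (2 + 1 / (real r - 1)) * ln n"
      using C ln by (intro mult_right_mono mult_left_mono) auto
    ultimately show ?thesis using square by linarith
  qed
  then show ?thesis
    using C by (intro exI[of _ C] conjI exI[of _ "1::nat"] exI[of _ "2::nat"]) blast+
qed

end
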